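(* Let $(D,\prec_1,\succ_1,\prec_2,\succ_2)$ be a compatible dendriform algebra and let $D^{\mathrm{Tot}}=(D,\star_1,\star_2)$ be the corresponding total compatible associative algebra, $x\star_iy=x\prec_iy+x\succ_iy$ for $i=1,2$. Then the collection of maps $$\Phi_n:C^n_{\mathrm{cDend}}(D,D)\to C^n_{\mathrm{cAss}}(D^{\mathrm{Tot}},D^{\mathrm{Tot}}),\quad\Phi_n((f_1,\ldots,f_n))=(f_1^{\mathrm{Tot}},\ldots,f_n^{\mathrm{Tot}}),\quad f_i^{\mathrm{Tot}}(x_1,\ldots,x_n)=\sum_{r=1}^nf_i([r];x_1,\ldots,x_n),$$ $n\ge1$, induces a morphism $H^\bullet_{\mathrm{cDend}}(D,D)\to H^\bullet_{\mathrm{cAss}}(D^{\mathrm{Tot}},D^{\mathrm{Tot}})$ between the corresponding cohomologies.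
   Context: All vector spaces are over a field $\mathbf{k}$ of characteristic $0$. A dendriform algebra is $(D,\prec,\succ)$ with bilinear operations satisfying $(x\prec y)\prec z=x\prec(y\prec z+y\succ z)$, $(x\succ y)\prec z=x\succ(y\prec z)$, $(x\prec y+x\succ y)\succ z=x\succ(y\succ z)$. A compatible dendriform algebra is $(D,\prec_1,\succ_1,\prec_2,\succ_2)$ such that $(D,\prec_1,\succ_1)$ and $(D,\prec_2,\succ_2)$ are dendriform algebras and for all $x,y,z\in D$ $$(x\prec_1y)\prec_2z+(x\prec_2y)\prec_1z=x\prec_2(y\prec_1z+y\succ_1z)+x\prec_1(y\prec_2z+y\succ_2z),$$ $$(x\succ_1y)\prec_2z+(x\succ_2y)\prec_1z=x\succ_2(y\prec_1z)+x\succ_1(y\prec_2z),$$ $$(x\prec_1y+x\succ_1y)\succ_2z+(x\prec_2y+x\succ_2y)\succ_1z=x\succ_2(y\succ_1z)+x\succ_1(y\succ_2z).$$ Cohomology of a compatible dendriform algebra. Let $C_n=\{[1],\ldots,[n]\}$ (symbols) and $\mathbf{k}[C_n]$ the vector space with basis $C_n$. For $m,n\ge1$, $1\le i\le m$, define $R_{m;i,n}:C_{m+n-1}\to C_m$ by $R_{m;i,n}([r])=[r]$ if $r\le i-1$, $=[i]$ if $i\le r\le i+n-1$, $=[r-n+1]$ if $r\ge i+n$; and $S_{m;i,n}:C_{m+n-1}\to\mathbf{k}[C_n]$ by $S_{m;i,n}([r])=[r-i+1]$ if $i\le r\le i+n-1$, and $=[1]+\cdots+[n]$ otherwise. For $f\in\mathrm{Hom}(\mathbf{k}[C_m]\otimes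 D^{\otimes m},D)$, $g\in\mathrm{Hom}(\mathbf{k}[C_n]\otimes D^{\otimes n},D)$ put $$(f\circ_ig)([r];x_1,\ldots,x_{m+n-1})=f\big(R_{m;i,n}[r];x_1,\ldots,x_{i-1},g(S_{m;i,n}[r];x_i,\ldots,x_{i+n-1}),x_{i+n},\ldots,x_{m+n-1}\big),$$ $$\{\!\!\{f,g\}\!\!\}=\sum_{i=1}^m(-1)^{(i-1)(n-1)}f\circ_ig-(-1)^{(m-1)(n-1)}\sum_{i=1}^n(-1)^{(i-1)(m-1)}g\circ_if.$$ Define $\pi_j\in\mathrm{Hom}(\mathbf{k}[C_2]\otimes D^{\otimes2},D)$, $j=1,2$, by $\pi_j([1];x,y)=x\prec_jy$, $\pi_j([2];x,y)=x\succ_jy$. For $n\ge1$ let $C^n_{\mathrm{cDend}}(D,D)$ be the direct sum of $n$ copies of $\mathrm{Hom}(\mathbf{k}[C_n]\otimes D^{\otimes n},D)$, with differential $$\delta_{\mathrm{cDend}}((f_1,\ldots,f_n))=(-1)^{n-1}\big(\{\!\!\{\pi_1,f_1\}\!\!\},\ldots,\underbrace{\{\!\!\{\pi_1,f_i\}\!\!\}+\{\!\!\{\pi_2,f_{i-1}\}\!\!\}}_{i\text{-th place}},\ldots,\{\!\!\{\pi_2,f_n\}\!\!\}\big).$$ The complex starts in degree $1$; its cohomology is $H^\bullet_{\mathrm{cDend}}(D,D)$. Cohomology of a compatible associative algebra. A compatible associative algebra is $(B,\cdot_1,\cdot_2)$ with both products associative and $(a\cdot_1b)\cdot_2c+(a\cdot_2b)\cdot_1c=a\cdot_2(b\cdot_1c)+a\cdot_1(b\cdot_2c)$.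 With coefficients in the adjoint compatible bimodule, let $C^0_{\mathrm{cAss}}(B,B)=\{m\in B: a\cdot_1m-m\cdot_1a=a\cdot_2m-m\cdot_2a\ \forall a\in B\}$ and, for $n\ge1$, $C^n_{\mathrm{cAss}}(B,B)$ the direct sum of $n$ copies of $\mathrm{Hom}(B^{\otimes n},B)$. Let $\delta^j_{\mathrm{Ass}}$ be the Hochschild coboundary of $(B,\cdot_j)$ with coefficients in itself: $\delta^j_{\mathrm{Ass}}(m)(a)=a\cdot_jm-m\cdot_ja$ and $\delta^j_{\mathrm{Ass}}f(a_1,\ldots,a_{n+1})=a_1\cdot_jf(a_2,\ldots,a_{n+1})+\sum_{i=1}^n(-1)^if(\ldots,a_i\cdot_ja_{i+1},\ldots)+(-1)^{n+1}f(a_1,\ldots,a_n)\cdot_ja_{n+1}$. The differential is $\delta_{\mathrm{cAss}}(m)=\delta^1_{\mathrm{Ass}}(m)=\delta^2_{\mathrm{Ass}}(m)$ and $$\delta_{\mathrm{cAss}}(f_1,\ldots,f_n)=\big(\delta^1_{\mathrm{Ass}}(f_1),\ldots,\underbrace{\delta^1_{\mathrm{Ass}}(f_i)+\delta^2_{\mathrm{Ass}}(f_{i-1})}_{i\text{-th place}},\ldots,\delta^2_{\mathrm{Ass}}(f_n)\big);$$ its cohomology is $H^\bullet_{\mathrm{cAss}}(B,B)$. *)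

theory Defs
  imports Complex_Main "HOL-Library.FuncSet" "HOL-Library.Function_Algebras"
begin

section \<open>Compatible dendriform and compatible associative algebras\<close>

definition bilinear_op ::
  "('k::field \<Rightarrow> 'd::ab_group_add \<Rightarrow> 'd) \<Rightarrow> ('d \<Rightarrow> 'd \<Rightarrow> 'd) \<Rightarrow> bool" where
  "bilinear_op s m \<longleftrightarrow>
     (\<forall>y. Vector_Spaces.linear s s (\<lambda>x. m x y)) \<and> (\<forall>x. Vector_Spaces.linear s s (m x))"

locale dendriform_algebra = vector_space scale
  for scale :: "'k::field_char_0 \<Rightarrow> 'd::ab_group_add \<Rightarrow> 'd" +
  fixes prec :: "'d \<Rightarrow> 'd \<Rightarrow> 'd"  (infixl "\<prec>" 70)
    and succ :: "'d \<Rightarrow> 'd \<Rightarrow> 'd"  (infixl "\<succ>" 70)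
  assumes bilinear_prec: "bilinear_op scale prec"
    and bilinear_succ: "bilinear_op scale succ"
    and prec_prec: "(x \<prec> y) \<prec> z = x \<prec> (y \<prec> z + y \<succ> z)"
    and succ_prec: "(x \<succ> y) \<prec> z = x \<succ> (y \<prec> z)"
    and succ_succ: "(x \<prec> y + x \<succ> y) \<succ> z = x \<succ> (y \<succ> z)"

locale compatible_dendriform_algebra =
  D1: dendriform_algebra scale prec1 succ1 + D2: dendriform_algebra scale prec2 succ2
  for scale :: "'k::field_char_0 \<Rightarrow> 'd::ab_group_add \<Rightarrow> 'd"
    and prec1 :: "'d \<Rightarrow> 'd \<Rightarrow> 'd"  (infixl "\<prec>\<^sub>1" 70)
    and succ1 :: "'d \<Rightarrow> 'd \<Rightarrow> 'd"  (infixl "\<succ>\<^sub>1" 70)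
    and prec2 :: "'d \<Rightarrow> 'd \<Rightarrow> 'd"  (infixl "\<prec>\<^sub>2" 70)
    and succ2 :: "'d \<Rightarrow> 'd \<Rightarrow> 'd"  (infixl "\<succ>\<^sub>2" 70) +
  assumes compat_prec_prec:
      "(x \<prec>\<^sub>1 y) \<prec>\<^sub>2 z + (x \<prec>\<^sub>2 y) \<prec>\<^sub>1 z
         = x \<prec>\<^sub>2 (y \<prec>\<^sub>1 z + y \<succ>\<^sub>1 z) + x \<prec>\<^sub>1 (y \<prec>\<^sub>2 z + y \<succ>\<^sub>2 z)"
    and compat_succ_prec:
      "(x \<succ>\<^sub>1 y) \<prec>\<^sub>2 z + (x \<succ>\<^sub>2 y) \<prec>\<^sub>1 z = x \<succ>\<^sub>2 (y \<prec>\<^sub>1 z) + x \<succ>\<^sub>1 (y \<prec>\<^sub>2 z)"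
    and compat_succ_succ:
      "(x \<prec>\<^sub>1 y + x \<succ>\<^sub>1 y) \<succ>\<^sub>2 z + (x \<prec>\<^sub>2 y + x \<succ>\<^sub>2 y) \<succ>\<^sub>1 z
         = x \<succ>\<^sub>2 (y \<succ>\<^sub>1 z) + x \<succ>\<^sub>1 (y \<succ>\<^sub>2 z)"

locale compatible_associative_algebra = vector_space scale
  for scale :: "'k::field_char_0 \<Rightarrow> 'b::ab_group_add \<Rightarrow> 'b" +
  fixes mul1 :: "'b \<Rightarrow> 'b \<Rightarrow> 'b"  (infixl "\<cdot>\<^sub>1" 70)
    and mul2 :: "'b \<Rightarrow> 'b \<Rightarrow> 'b"  (infixl "\<cdot>\<^sub>2" 70)
  assumes bilinear_mul1: "bilinear_op scale mul1"
    and bilinear_mul2: "bilinear_op scale mul2"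
    and assoc1: "(a \<cdot>\<^sub>1 b) \<cdot>\<^sub>1 c = a \<cdot>\<^sub>1 (b \<cdot>\<^sub>1 c)"
    and assoc2: "(a \<cdot>\<^sub>2 b) \<cdot>\<^sub>2 c = a \<cdot>\<^sub>2 (b \<cdot>\<^sub>2 c)"
    and compat: "(a \<cdot>\<^sub>1 b) \<cdot>\<^sub>2 c + (a \<cdot>\<^sub>2 b) \<cdot>\<^sub>1 c = a \<cdot>\<^sub>2 (b \<cdot>\<^sub>1 c) + a \<cdot>\<^sub>1 (b \<cdot>\<^sub>2 c)"

definition tot :: "('d \<Rightarrow> 'd \<Rightarrow> 'd) \<Rightarrow> ('d \<Rightarrow> 'd \<Rightarrow> 'd) \<Rightarrow> 'd \<Rightarrow> 'd \<Rightarrow> 'd::ab_group_add" where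
  "tot prec succ x y = prec x y + succ x y"

lemma bilinear_opD:
  assumes "bilinear_op s m"
  shows "m (x + x') y = m x y + m x' y" "m x (y + y') = m x y + m x y'"
proof -
  have "Vector_Spaces.linear s s (\<lambda>x. m x y)" "Vector_Spaces.linear s s (m x)"
    using assms by (auto simp: bilinear_op_def)
  then show "m (x + x') y = m x y + m x' y" "m x (y + y') = m x y + m x y'"
    by (auto simp: linear_iff_module_hom dest: module_hom.add)
qed

lemma bilinear_op_tot:
  assumes "bilinear_op s m" "bilinear_op s m'"
  shows "bilinear_op s (tot m m')"
proof -
  have add: "Vector_Spaces.linear s s (\<lambda>x. f x + g x)"
    if f: "Vector_Spaces.linear s s f" and g: "Vector_Spaces.linear s s g" for f g
  proof -
    interpret vector_space_pair s s
      using f by (simp add: Vector_Spaces.linear_def vector_space_pair_def)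
    show ?thesis by (rule linear_compose_add[OF f g])
  qed
  show ?thesis
    using assms by (auto simp: bilinear_op_def tot_def[abs_def] intro: add)
qed

lemma compatible_associative_tot:
  assumes "compatible_dendriform_algebra s prec1 succ1 prec2 succ2"
  shows "compatible_associative_algebra s (tot prec1 succ1) (tot prec2 succ2)"
proof -
  interpret compatible_dendriform_algebra s prec1 succ1 prec2 succ2 by (rule assms)
  note bil = bilinear_opD[OF D1.bilinear_prec] bilinear_opD[OF D1.bilinear_succ]
    bilinear_opD[OF D2.bilinear_prec] bilinear_opD[OF D2.bilinear_succ]
  show ?thesis
  proof
    fix x y z
    show "tot prec1 succ1 (tot prec1 succ1 x y) z = tot prec1 succ1 x (tot prec1 succ1 y z)"
      using D1.prec_prec[of x y z] D1.succ_prec[of x y z] D1.succ_succ[of x y z]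
      by (simp add: tot_def bil ac_simps)
    show "tot prec2 succ2 (tot prec2 succ2 x y) z = tot prec2 succ2 x (tot prec2 succ2 y z)"
      using D2.prec_prec[of x y z] D2.succ_prec[of x y z] D2.succ_succ[of x y z]
      by (simp add: tot_def bil ac_simps)
    let ?a = "(prec2 (prec1 x y) z + prec1 (prec2 x y) z)
      + (prec2 (succ1 x y) z + prec1 (succ2 x y) z)
      + (succ2 (prec1 x y + succ1 x y) z + succ1 (prec2 x y + succ2 x y) z)"
    show "tot prec2 succ2 (tot prec1 succ1 x y) z + tot prec1 succ1 (tot prec2 succ2 x y) z
        = tot prec2 succ2 x (tot prec1 succ1 y z) + tot prec1 succ1 x (tot prec2 succ2 y z)"
      (is "?l = ?r")
    proof -
      have "?l = ?a" by (simp add: tot_def bil ac_simps)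
      also have "\<dots> = ?r"
        unfolding compat_prec_prec compat_succ_prec compat_succ_succ
        by (simp add: tot_def bil ac_simps)
      finally show ?thesis .
    qed
  qed (rule bilinear_op_tot D1.bilinear_prec D1.bilinear_succ D2.bilinear_prec D2.bilinear_succ)+
qed

section \<open>Cohomology of a cochain complex\<close>

text \<open>
  A complex is given by subspaces \<open>C n\<close> of one ambient type and maps \<open>d n\<close> from \<open>C n\<close> to
  \<open>C (n + 1)\<close>; the complex is zero in negative degrees.
\<close>

definition cocycles :: "(nat \<Rightarrow> 'a::ab_group_add set) \<Rightarrow> (nat \<Rightarrow> 'a \<Rightarrow> 'a) \<Rightarrow> nat \<Rightarrow> 'a set" where
  "cocycles C d n = {x \<in> C n. d n x = 0}"

definition coboundaries :: "(nat \<Rightarrow> 'a::ab_group_add set) \<Rightarrow> (nat \<Rightarrow> 'a \<Rightarrow> 'a) \<Rightarrow> nat \<Rightarrow> 'a set" where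
  "coboundaries C d n = (case n of 0 \<Rightarrow> {0} | Suc k \<Rightarrow> d k ` C k)"

definition cohomologous :: "(nat \<Rightarrow> 'a::ab_group_add set) \<Rightarrow> (nat \<Rightarrow> 'a \<Rightarrow> 'a) \<Rightarrow> nat \<Rightarrow> 'a rel" where
  "cohomologous C d n =
     {(x, y). x \<in> cocycles C d n \<and> y \<in> cocycles C d n \<and> x - y \<in> coboundaries C d n}"

definition cohomology :: "(nat \<Rightarrow> 'a::ab_group_add set) \<Rightarrow> (nat \<Rightarrow> 'a \<Rightarrow> 'a) \<Rightarrow> nat \<Rightarrow> 'a set set" where
  "cohomology C d n = cocycles C d n // cohomologous C d n"

definition cohomology_class ::
  "(nat \<Rightarrow> 'a::ab_group_add set) \<Rightarrow> (nat \<Rightarrow> 'a \<Rightarrow> 'a) \<Rightarrow> nat \<Rightarrow> 'a \<Rightarrow> 'a set" where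
  "cohomology_class C d n x = cohomologous C d n `` {x}"

text \<open>The vector space operations on classes, computed on representatives.\<close>

definition class_add ::
  "(nat \<Rightarrow> 'a::ab_group_add set) \<Rightarrow> (nat \<Rightarrow> 'a \<Rightarrow> 'a) \<Rightarrow> nat \<Rightarrow> 'a set \<Rightarrow> 'a set \<Rightarrow> 'a set" where
  "class_add C d n X Y = (\<Union>x\<in>X. \<Union>y\<in>Y. cohomology_class C d n (x + y))"

definition class_scale ::
  "('k \<Rightarrow> 'a \<Rightarrow> 'a) \<Rightarrow> (nat \<Rightarrow> 'a::ab_group_add set) \<Rightarrow> (nat \<Rightarrow> 'a \<Rightarrow> 'a) \<Rightarrow> nat \<Rightarrow>
   'k \<Rightarrow> 'a set \<Rightarrow> 'a set" where
  "class_scale s C d n c X = (\<Union>x\<in>X. cohomology_class C d n (s c x))"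

definition cohomology_linear ::
  "('k \<Rightarrow> 'a \<Rightarrow> 'a) \<Rightarrow> (nat \<Rightarrow> 'a::ab_group_add set) \<Rightarrow> (nat \<Rightarrow> 'a \<Rightarrow> 'a) \<Rightarrow>
   ('k \<Rightarrow> 'b \<Rightarrow> 'b) \<Rightarrow> (nat \<Rightarrow> 'b::ab_group_add set) \<Rightarrow> (nat \<Rightarrow> 'b \<Rightarrow> 'b) \<Rightarrow>
   nat \<Rightarrow> ('a set \<Rightarrow> 'b set) \<Rightarrow> bool" where
  "cohomology_linear s C d s' C' d' n h \<longleftrightarrow>
     h \<in> cohomology C d n \<rightarrow> cohomology C' d' n \<and>
     (\<forall>X\<in>cohomology C d n. \<forall>Y\<in>cohomology C d n.
        h (class_add C d n X Y) = class_add C' d' n (h X) (h Y)) \<and>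
     (\<forall>c. \<forall>X\<in>cohomology C d n.
        h (class_scale s C d n c X) = class_scale s' C' d' n c (h X))"

section \<open>Cochains\<close>

text \<open>
  \<open>Hom(D\<^sup>\<otimes>\<^sup>n, D)\<close> as the multilinear maps on lists of length \<open>n\<close>, made zero on all other lists so
  that a cochain is determined by its values on lists of length \<open>n\<close>.
\<close>

definition multilinear_maps ::
  "('k::field \<Rightarrow> 'd::ab_group_add \<Rightarrow> 'd) \<Rightarrow> nat \<Rightarrow> ('d list \<Rightarrow> 'd) set" where
  "multilinear_maps s n =
     {f. (\<forall>xs i. length xs = n \<longrightarrow> i < n \<longrightarrow> Vector_Spaces.linear s s (\<lambda>x. f (xs[i := x]))) \<and>
         (\<forall>xs. length xs \<noteq> n \<longrightarrow> f xs = 0)}"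

text \<open>\<open>n\<close>-tuples of elements of \<open>A\<close>, indexed by \<open>1, \<dots>, n\<close> and zero at all other indices.\<close>

definition tuples :: "nat \<Rightarrow> 'a::zero set \<Rightarrow> (nat \<Rightarrow> 'a) set" where
  "tuples n A = {F. (\<forall>i\<in>{1..n}. F i \<in> A) \<and> (\<forall>i. i \<notin> {1..n} \<longrightarrow> F i = 0)}"

definition tuple_diff ::
  "('a \<Rightarrow> 'a) \<Rightarrow> ('a \<Rightarrow> 'a) \<Rightarrow> nat \<Rightarrow> (nat \<Rightarrow> 'a::ab_group_add) \<Rightarrow> nat \<Rightarrow> 'a" where
  "tuple_diff d1 d2 n F i =
     (if i \<in> {1..n+1}
      then (if i \<le> n then d1 (F i) else 0) + (if 2 \<le> i then d2 (F (i - 1)) else 0)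
      else 0)"

section \<open>The complex of a compatible dendriform algebra\<close>

text \<open>
  The symbol \<open>[r]\<close> of \<open>C\<^sub>n\<close> is the number \<open>r \<in> {1..n}\<close>. A linear map on \<open>k[C\<^sub>n] \<otimes> D\<^sup>\<otimes>\<^sup>n\<close> is given by
  its values \<open>f r xs\<close> at the basis symbols; \<open>lin_ext\<close> evaluates it at an arbitrary vector of
  \<open>k[C\<^sub>n]\<close>, which is represented by its coordinate function.
\<close>

definition dend_homs ::
  "('k::field \<Rightarrow> 'd::ab_group_add \<Rightarrow> 'd) \<Rightarrow> nat \<Rightarrow> (nat \<Rightarrow> 'd list \<Rightarrow> 'd) set" where
  "dend_homs s n = tuples n (multilinear_maps s n)"

definition lin_ext ::
  "('k::field \<Rightarrow> 'd::ab_group_add \<Rightarrow> 'd) \<Rightarrow> nat \<Rightarrow> (nat \<Rightarrow> 'd list \<Rightarrow> 'd) \<Rightarrow>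
   (nat \<Rightarrow> 'k) \<Rightarrow> 'd list \<Rightarrow> 'd" where
  "lin_ext s n g v xs = (\<Sum>t = 1..n. s (v t) (g t xs))"

text \<open>The formulas for \<open>R\<^sub>m\<^sub>;\<^sub>i\<^sub>,\<^sub>n\<close> and \<open>S\<^sub>m\<^sub>;\<^sub>i\<^sub>,\<^sub>n\<close> do not involve \<open>m\<close>.\<close>

definition R_map :: "nat \<Rightarrow> nat \<Rightarrow> nat \<Rightarrow> nat" where
  "R_map i n r = (if r < i then r else if r < i + n then i else r - n + 1)"

definition S_map :: "nat \<Rightarrow> nat \<Rightarrow> nat \<Rightarrow> nat \<Rightarrow> 'k::field" where
  "S_map i n r =
     (if i \<le> r \<and> r < i + n then (\<lambda>t. if t = r - i + 1 then 1 else 0)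
      else (\<lambda>t. if t \<in> {1..n} then 1 else 0))"

definition circ ::
  "('k::field \<Rightarrow> 'd::ab_group_add \<Rightarrow> 'd) \<Rightarrow> nat \<Rightarrow> nat \<Rightarrow> nat \<Rightarrow>
   (nat \<Rightarrow> 'd list \<Rightarrow> 'd) \<Rightarrow> (nat \<Rightarrow> 'd list \<Rightarrow> 'd) \<Rightarrow> nat \<Rightarrow> 'd list \<Rightarrow> 'd" where
  "circ s m n i f g r xs =
     (if r \<in> {1..m + n - 1} \<and> length xs = m + n - 1
      then f (R_map i n r)
             (take (i - 1) xs
              @ [lin_ext s n g (S_map i n r) (take n (drop (i - 1) xs))]
              @ drop (i + n - 1) xs)
      else 0)"

text \<open>The arguments \<open>m\<close> and \<open>n\<close> are the arities of \<open>f\<close> and \<open>g\<close>, both at least 1.\<close>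

definition dend_bracket ::
  "('k::field \<Rightarrow> 'd::ab_group_add \<Rightarrow> 'd) \<Rightarrow> nat \<Rightarrow> nat \<Rightarrow>
   (nat \<Rightarrow> 'd list \<Rightarrow> 'd) \<Rightarrow> (nat \<Rightarrow> 'd list \<Rightarrow> 'd) \<Rightarrow> nat \<Rightarrow> 'd list \<Rightarrow> 'd" where
  "dend_bracket s m n f g r xs =
     (\<Sum>i = 1..m. s ((-1) ^ ((i - 1) * (n - 1))) (circ s m n i f g r xs))
     - s ((-1) ^ ((m - 1) * (n - 1)))
         (\<Sum>i = 1..n. s ((-1) ^ ((i - 1) * (m - 1))) (circ s n m i g f r xs))"

definition dend_pi ::
  "('d \<Rightarrow> 'd \<Rightarrow> 'd) \<Rightarrow> ('d \<Rightarrow> 'd \<Rightarrow> 'd) \<Rightarrow> nat \<Rightarrow> 'd list \<Rightarrow> 'd::ab_group_add" where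
  "dend_pi prec succ r xs =
     (if length xs = 2 \<and> r = 1 then prec (xs ! 0) (xs ! 1)
      else if length xs = 2 \<and> r = 2 then succ (xs ! 0) (xs ! 1)
      else 0)"

text \<open>In degree \<open>0\<close> this is the zero space: the complex starts in degree \<open>1\<close>.\<close>

definition cDend_cochains ::
  "('k::field \<Rightarrow> 'd::ab_group_add \<Rightarrow> 'd) \<Rightarrow> nat \<Rightarrow> (nat \<Rightarrow> nat \<Rightarrow> 'd list \<Rightarrow> 'd) set" where
  "cDend_cochains s n = tuples n (dend_homs s n)"

definition cDend_diff ::
  "('k::field \<Rightarrow> 'd::ab_group_add \<Rightarrow> 'd) \<Rightarrow>
   ('d \<Rightarrow> 'd \<Rightarrow> 'd) \<Rightarrow> ('d \<Rightarrow> 'd \<Rightarrow> 'd) \<Rightarrow> ('d \<Rightarrow> 'd \<Rightarrow> 'd) \<Rightarrow> ('d \<Rightarrow> 'd \<Rightarrow> 'd) \<Rightarrow>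
   nat \<Rightarrow> (nat \<Rightarrow> nat \<Rightarrow> 'd list \<Rightarrow> 'd) \<Rightarrow> nat \<Rightarrow> nat \<Rightarrow> 'd list \<Rightarrow> 'd" where
  "cDend_diff s prec1 succ1 prec2 succ2 n F = (\<lambda>i r xs.
     s ((-1) ^ (n - 1))
       (tuple_diff (dend_bracket s 2 n (dend_pi prec1 succ1))
                   (dend_bracket s 2 n (dend_pi prec2 succ2)) n F i r xs))"

definition cDend_scale ::
  "('k::field \<Rightarrow> 'd::ab_group_add \<Rightarrow> 'd) \<Rightarrow> 'k \<Rightarrow>
   (nat \<Rightarrow> nat \<Rightarrow> 'd list \<Rightarrow> 'd) \<Rightarrow> nat \<Rightarrow> nat \<Rightarrow> 'd list \<Rightarrow> 'd" where
  "cDend_scale s c F = (\<lambda>i r xs. s c (F i r xs))"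

section \<open>The complex of a compatible associative algebra\<close>

text \<open>
  For \<open>n = 0\<close> and \<open>f [] = b\<close> this is \<open>a \<mapsto> a \<cdot> b - b \<cdot> a\<close>.
\<close>

definition hochschild ::
  "('k::field \<Rightarrow> 'b::ab_group_add \<Rightarrow> 'b) \<Rightarrow> ('b \<Rightarrow> 'b \<Rightarrow> 'b) \<Rightarrow> nat \<Rightarrow>
   ('b list \<Rightarrow> 'b) \<Rightarrow> 'b list \<Rightarrow> 'b" where
  "hochschild s mul n f xs =
     (if length xs = n + 1
      then mul (hd xs) (f (tl xs))
           + (\<Sum>i = 1..n. s ((-1) ^ i)
                (f (take (i - 1) xs @ [mul (xs ! (i - 1)) (xs ! i)] @ drop (i + 1) xs)))
           + s ((-1) ^ (n + 1)) (mul (f (butlast xs)) (last xs))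
      else 0)"

text \<open>
  A \<open>0\<close>-cochain \<open>b \<in> B\<close> is stored as the family whose only nonzero entry has index \<open>1\<close> and is
  the map \<open>[] \<mapsto> b\<close> of arity \<open>0\<close>.
\<close>

definition const_cochain :: "'b \<Rightarrow> nat \<Rightarrow> 'b list \<Rightarrow> 'b::ab_group_add" where
  "const_cochain b = (\<lambda>i xs. if i = 1 \<and> xs = [] then b else 0)"

definition cAss_cochains ::
  "('k::field \<Rightarrow> 'b::ab_group_add \<Rightarrow> 'b) \<Rightarrow> ('b \<Rightarrow> 'b \<Rightarrow> 'b) \<Rightarrow> ('b \<Rightarrow> 'b \<Rightarrow> 'b) \<Rightarrow>
   nat \<Rightarrow> (nat \<Rightarrow> 'b list \<Rightarrow> 'b) set" where
  "cAss_cochains s mul1 mul2 n =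
     (if n = 0 then const_cochain ` {b. \<forall>a. mul1 a b - mul1 b a = mul2 a b - mul2 b a}
      else tuples n (multilinear_maps s n))"

definition cAss_diff ::
  "('k::field \<Rightarrow> 'b::ab_group_add \<Rightarrow> 'b) \<Rightarrow> ('b \<Rightarrow> 'b \<Rightarrow> 'b) \<Rightarrow> ('b \<Rightarrow> 'b \<Rightarrow> 'b) \<Rightarrow>
   nat \<Rightarrow> (nat \<Rightarrow> 'b list \<Rightarrow> 'b) \<Rightarrow> nat \<Rightarrow> 'b list \<Rightarrow> 'b" where
  "cAss_diff s mul1 mul2 n F =
     (if n = 0 then (\<lambda>i. if i = 1 then hochschild s mul1 0 (F 1) else 0)
      else tuple_diff (hochschild s mul1 n) (hochschild s mul2 n) n F)"

definition cAss_scale ::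
  "('k::field \<Rightarrow> 'b::ab_group_add \<Rightarrow> 'b) \<Rightarrow> 'k \<Rightarrow>
   (nat \<Rightarrow> 'b list \<Rightarrow> 'b) \<Rightarrow> nat \<Rightarrow> 'b list \<Rightarrow> 'b" where
  "cAss_scale s c F = (\<lambda>i xs. s c (F i xs))"

section \<open>The comparison maps\<close>

definition tot_cochain :: "nat \<Rightarrow> (nat \<Rightarrow> 'd list \<Rightarrow> 'd) \<Rightarrow> 'd list \<Rightarrow> 'd::ab_group_add" where
  "tot_cochain n f xs = (\<Sum>r = 1..n. f r xs)"

text \<open>In degree \<open>0\<close>, where the source is the zero space, \<open>Phi\<close> is the zero map.\<close>

definition Phi ::
  "nat \<Rightarrow> (nat \<Rightarrow> nat \<Rightarrow> 'd list \<Rightarrow> 'd) \<Rightarrow> nat \<Rightarrow> 'd list \<Rightarrow> 'd::ab_group_add" where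
  "Phi n F = (\<lambda>i. if i \<in> {1..n} then tot_cochain n (F i) else 0)"

end

theory Submission
  imports Defs
begin

text \<open>
  Totalization \<open>f \<mapsto> f\<^sup>T\<^sup>o\<^sup>t\<close>, the sum of the components \<open>f([r]; -)\<close>, turns the partial compositions of
  the dendriform setting into the ordinary partial compositions of multilinear maps:
  \<open>(f \<circ>\<^sub>i g)\<^sup>T\<^sup>o\<^sup>t = f\<^sup>T\<^sup>o\<^sup>t \<circ>\<^sub>i g\<^sup>T\<^sup>o\<^sup>t\<close> (lemma \<open>tot_cochain_circ\<close>). The symbols \<open>[r]\<close> outside the block
  \<open>i, \<dots>, i + n - 1\<close> run through the components of \<open>f\<close> other than the \<open>i\<close>-th, each with the full sum
  \<open>g\<^sup>T\<^sup>o\<^sup>t\<close> inserted; the symbols inside the block give the component \<open>f([i]; -)\<close> with the \<open>n\<close> components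
  of \<open>g\<close> inserted one at a time, and these recombine to \<open>g\<^sup>T\<^sup>o\<^sup>t\<close> because \<open>f([i]; -)\<close> is additive in
  its \<open>i\<close>-th argument.

  The total of \<open>\<pi>\<^sub>j\<close> is the associative product \<open>\<star>\<^sub>j\<close>. Hence the total of the bracket of \<open>\<pi>\<^sub>j\<close> with
  \<open>f\<close> is the bracket of \<open>\<star>\<^sub>j\<close> with \<open>f\<^sup>T\<^sup>o\<^sup>t\<close>, which up to the sign \<open>(-1)\<^sup>n\<^sup>-\<^sup>1\<close> is the Hochschild
  coboundary of \<open>f\<^sup>T\<^sup>o\<^sup>t\<close> (lemma \<open>tot_cochain_dend_bracket_dend_pi\<close>). Both differentials arrange these
  brackets and coboundaries on tuples in the same way, so \<open>Phi\<close> is a chain map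
  (lemma \<open>Phi_cDend_diff\<close>), and the rest is the general fact that a linear chain map
  induces linear maps on cohomology (locale \<open>chain_map\<close>).
\<close>

section \<open>Cohomology of a linear complex\<close>

text \<open>
  The differential is linear on the whole ambient space, and \<open>C n\<close> is a subspace of it. This makes
  cocycles (a kernel meeting a subspace) and coboundaries (an image of a subspace) accessible
  to the library facts on linear maps.
\<close>

locale linear_complex = vector_space scale
  for scale :: "'k::field \<Rightarrow> 'a::ab_group_add \<Rightarrow> 'a" +
  fixes C :: "nat \<Rightarrow> 'a set"
    and d :: "nat \<Rightarrow> 'a \<Rightarrow> 'a"
  assumes subspace_cochains: "subspace (C n)"
    and linear_d: "Vector_Spaces.linear scale scale (d n)"
begin

lemma subspace_cocycles: "subspace (cocycles C d n)"
proof -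
  interpret d: Vector_Spaces.linear scale scale "d n" by (rule linear_d)
  have "cocycles C d n = C n \<inter> {x. d n x = 0}"
    by (auto simp: cocycles_def)
  then show ?thesis
    by (simp add: subspace_inter subspace_cochains d.subspace_kernel)
qed

lemma subspace_coboundaries: "subspace (coboundaries C d n)"
proof (cases n)
  case 0
  then show ?thesis by (simp add: coboundaries_def subspace_single_0)
next
  case (Suc k)
  interpret d: Vector_Spaces.linear scale scale "d k" by (rule linear_d)
  show ?thesis
    using Suc by (simp add: coboundaries_def d.subspace_image subspace_cochains)
qed

lemma mem_cohomology_class_iff:
  "y \<in> cohomology_class C d n x \<longleftrightarrow>
     x \<in> cocycles C d n \<and> y \<in> cocycles C d n \<and> x - y \<in> coboundaries C d n"
  by (simp add: cohomology_class_def cohomologous_def)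

lemma mem_own_cohomology_class:
  "x \<in> cocycles C d n \<Longrightarrow> x \<in> cohomology_class C d n x"
  by (simp add: mem_cohomology_class_iff subspace_0[OF subspace_coboundaries])

text \<open>
  Two cocycles that differ by a coboundary differ from any third element by coboundaries
  simultaneously, because coboundaries form a group.
\<close>

lemma cohomology_class_eqI:
  assumes "x \<in> cocycles C d n" "y \<in> cocycles C d n" "x - y \<in> coboundaries C d n"
  shows "cohomology_class C d n x = cohomology_class C d n y"
proof -
  note B = subspace_coboundaries[of n]
  have "x - z \<in> coboundaries C d n \<longleftrightarrow> y - z \<in> coboundaries C d n" for z
    using subspace_add[OF B assms(3), of "y - z"] subspace_diff[OF B _ assms(3), of "x - z"]
    by auto
  then show ?thesis
    using assms by (auto simp: mem_cohomology_class_iff)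
qed

lemma cohomology_eq_classes:
  "cohomology C d n = cohomology_class C d n ` cocycles C d n"
  by (auto simp: cohomology_def quotient_def cohomology_class_def)

text \<open>
  The next two lemmas say that the operations on classes do not depend on representatives:
  the union defining them runs over a nonempty family of equal sets.
\<close>

lemma class_add_cohomology_class:
  assumes "x \<in> cocycles C d n" "y \<in> cocycles C d n"
  shows "class_add C d n (cohomology_class C d n x) (cohomology_class C d n y)
       = cohomology_class C d n (x + y)"
proof -
  have "cohomology_class C d n (x' + y') = cohomology_class C d n (x + y)"
    if "x' \<in> cohomology_class C d n x" "y' \<in> cohomology_class C d n y" for x' y'
  proof (rule cohomology_class_eqI[symmetric])
    have "(x - x') + (y - y') \<in> coboundaries C d n"
      using that by (intro subspace_add[OF subspace_coboundaries])
        (auto simp: mem_cohomology_class_iff)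
    then show "(x + y) - (x' + y') \<in> coboundaries C d n"
      by (simp add: algebra_simps)
  qed (use that in \<open>auto simp: mem_cohomology_class_iff
        intro: subspace_add[OF subspace_cocycles]\<close>)
  then show ?thesis
    unfolding class_add_def using assms mem_own_cohomology_class by blast
qed

lemma class_scale_cohomology_class:
  assumes "x \<in> cocycles C d n"
  shows "class_scale scale C d n c (cohomology_class C d n x)
       = cohomology_class C d n (scale c x)"
proof -
  have "cohomology_class C d n (scale c x') = cohomology_class C d n (scale c x)"
    if "x' \<in> cohomology_class C d n x" for x'
  proof (rule cohomology_class_eqI[symmetric])
    have "scale c (x - x') \<in> coboundaries C d n"
      using that by (intro subspace_scale[OF subspace_coboundaries])
        (auto simp: mem_cohomology_class_iff)
    then show "scale c x - scale c x' \<in> coboundaries C d n"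
      by (simp add: scale_right_diff_distrib)
  qed (use that in \<open>auto simp: mem_cohomology_class_iff
        intro: subspace_scale[OF subspace_cocycles]\<close>)
  then show ?thesis
    unfolding class_scale_def using assms mem_own_cohomology_class by blast
qed

end

locale chain_map =
  source: linear_complex scale C d + target: linear_complex scale' C' d'
  for scale :: "'k::field \<Rightarrow> 'a::ab_group_add \<Rightarrow> 'a" and C d
    and scale' :: "'k \<Rightarrow> 'b::ab_group_add \<Rightarrow> 'b" and C' d' +
  fixes \<phi> :: "nat \<Rightarrow> 'a \<Rightarrow> 'b"
  assumes linear_map: "Vector_Spaces.linear scale scale' (\<phi> n)"
    and maps_cochains: "\<phi> n \<in> C n \<rightarrow> C' n"
    and commutes: "x \<in> C n \<Longrightarrow> \<phi> (Suc n) (d n x) = d' n (\<phi> n x)"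
begin

sublocale map: Vector_Spaces.linear scale scale' "\<phi> n" for n
  by (rule linear_map)

lemma maps_cocycles: "x \<in> cocycles C d n \<Longrightarrow> \<phi> n x \<in> cocycles C' d' n"
  using maps_cochains[of n] commutes[of x n] by (auto simp: cocycles_def map.zero)

lemma maps_coboundaries: "x \<in> coboundaries C d n \<Longrightarrow> \<phi> n x \<in> coboundaries C' d' n"
  using maps_cochains commutes
  by (cases n) (auto simp: coboundaries_def map.zero Pi_iff)

text \<open>
  Like \<open>class_add\<close> and \<open>class_scale\<close>, the induced map is the union over all representatives; since
  \<open>\<phi>\<close> maps coboundaries to coboundaries, all members of this union are equal.
\<close>

definition induced :: "nat \<Rightarrow> 'a set \<Rightarrow> 'b set" where
  "induced n X = (\<Union>x\<in>X. cohomology_class C' d' n (\<phi> n x))"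

lemma induced_cohomology_class:
  assumes "x \<in> cocycles C d n"
  shows "induced n (cohomology_class C d n x) = cohomology_class C' d' n (\<phi> n x)"
proof -
  have "cohomology_class C' d' n (\<phi> n y) = cohomology_class C' d' n (\<phi> n x)"
    if "y \<in> cohomology_class C d n x" for y
  proof (rule target.cohomology_class_eqI[symmetric])
    show "\<phi> n x - \<phi> n y \<in> coboundaries C' d' n"
      using that maps_coboundaries[of "x - y" n]
      by (simp add: source.mem_cohomology_class_iff map.diff)
  qed (use that maps_cocycles in \<open>auto simp: source.mem_cohomology_class_iff\<close>)
  then show ?thesis
    unfolding induced_def using assms source.mem_own_cohomology_class by blast
qed

lemma cohomology_linear_induced:
  "cohomology_linear scale C d scale' C' d' n (induced n)"
  unfolding cohomology_linear_def source.cohomology_eq_classes target.cohomology_eq_classes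
  by (auto simp: induced_cohomology_class maps_cocycles map.add map.scale
      source.class_add_cohomology_class source.class_scale_cohomology_class
      target.class_add_cohomology_class target.class_scale_cohomology_class
      source.subspace_add[OF source.subspace_cocycles]
      source.subspace_scale[OF source.subspace_cocycles])

end

section \<open>Pointwise linear structure on spaces of maps\<close>

lemma vector_space_pointwise:
  assumes "vector_space s"
  shows "vector_space (\<lambda>c f x. s c (f x))"
proof -
  interpret vector_space s by (rule assms)
  show ?thesis
    by unfold_locales (auto simp: fun_eq_iff scale_right_distrib scale_left_distrib)
qed

lemma vector_space_cAss_scale: "vector_space s \<Longrightarrow> vector_space (cAss_scale s)"
  unfolding cAss_scale_def[abs_def] by (intro vector_space_pointwise)

lemma vector_space_cDend_scale: "vector_space s \<Longrightarrow> vector_space (cDend_scale s)"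
  unfolding cDend_scale_def[abs_def] by (intro vector_space_pointwise)

lemma subspace_tuples:
  assumes "vector_space s" "module.subspace s A"
  shows "module.subspace (\<lambda>c F i. s c (F i)) (tuples n A)"
proof -
  interpret A: vector_space s by (rule assms)
  interpret vector_space "\<lambda>c F i. s c (F i)" by (intro vector_space_pointwise assms)
  show ?thesis
    using assms(2) by (auto simp: subspace_def A.subspace_def tuples_def)
qed

lemma subspace_multilinear_maps:
  assumes "vector_space s"
  shows "module.subspace (\<lambda>c f xs. s c (f xs)) (multilinear_maps s n)"
proof -
  interpret A: vector_space s by (rule assms)
  interpret AA: vector_space_pair s s by unfold_locales
  interpret vector_space "\<lambda>c f xs. s c (f xs)" by (intro vector_space_pointwise assms)
  show ?thesis
    by (auto simp: subspace_def multilinear_maps_def AA.module_hom_zero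
        intro!: AA.linear_compose_add AA.linear_compose_scale_right AA.linear_zero)
qed

lemma linear_tuple_diff:
  assumes "vector_space s" "Vector_Spaces.linear s s d1" "Vector_Spaces.linear s s d2"
  shows "Vector_Spaces.linear (\<lambda>c F i. s c (F i)) (\<lambda>c F i. s c (F i)) (tuple_diff d1 d2 n)"
proof -
  interpret vector_space s by (rule assms)
  show ?thesis
    using assms vector_space_pointwise[OF assms(1)]
    by (auto simp: Vector_Spaces.linear_iff tuple_diff_def fun_eq_iff scale_right_distrib)
qed

section \<open>The two differentials are linear\<close>

lemma linear_hochschild:
  assumes "vector_space s" "bilinear_op s mul"
  shows "Vector_Spaces.linear (\<lambda>c f xs. s c (f xs)) (\<lambda>c f xs. s c (f xs)) (hochschild s mul n)"
proof -
  interpret vector_space s by (rule assms)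
  have 1: "mul x (s c y) = s c (mul x y)" "mul (s c x) y = s c (mul x y)" for c x y
    using assms(2) by (auto simp: bilinear_op_def Vector_Spaces.linear_iff)
  show ?thesis
    using vector_space_pointwise[OF assms(1)]
    by (auto simp: Vector_Spaces.linear_iff hochschild_def fun_eq_iff scale_right_distrib 1
        bilinear_opD[OF assms(2)] sum.distrib scale_sum_right scale_right_diff_distrib mult.commute)
qed

lemma multilinear_mapsD:
  assumes "f \<in> multilinear_maps s n" "length as + length bs + 1 = n"
  shows "Vector_Spaces.linear s s (\<lambda>x. f (as @ [x] @ bs))"
proof -
  have "Vector_Spaces.linear s s (\<lambda>x. f ((as @ [0] @ bs)[length as := x]))"
    using assms unfolding multilinear_maps_def
    by (elim CollectE conjE allE[of _ "as @ [0] @ bs"] allE[of _ "length as"]) auto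
  then show ?thesis by simp
qed

text \<open>
  The inserted map enters through \<open>lin_ext\<close>, which depends linearly on it, and then through one
  argument of a multilinear component of \<open>f\<close>.
\<close>

lemma linear_circ_right:
  assumes "vector_space s" "f \<in> dend_homs s m" "1 \<le> i" "i \<le> m"
  shows "Vector_Spaces.linear (\<lambda>c g r xs. s c (g r xs)) s (\<lambda>g. circ s m n i f g r xs)"
proof -
  interpret vector_space s by (rule assms)
  note vs = vector_space_pointwise[OF vector_space_pointwise[OF assms(1)]] assms(1)
  have lin_add: "lin_ext s n (g + h) v ys = lin_ext s n g v ys + lin_ext s n h v ys" for g h v ys
    by (simp add: lin_ext_def scale_right_distrib sum.distrib)
  have lin_scale: "lin_ext s n (\<lambda>r xs. s c (g r xs)) v ys = s c (lin_ext s n g v ys)" for c g v ys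
    by (simp add: lin_ext_def scale_sum_right mult.commute)
  show ?thesis
  proof (cases "r \<in> {1..m + n - 1} \<and> length xs = m + n - 1")
    case True
    have "R_map i n r \<in> {1..m}"
      using True assms by (auto simp: R_map_def)
    then have "f (R_map i n r) \<in> multilinear_maps s m"
      using assms by (auto simp: dend_homs_def tuples_def)
    then have "Vector_Spaces.linear s s
        (\<lambda>x. f (R_map i n r) (take (i - 1) xs @ [x] @ drop (i + n - 1) xs))"
      by (rule multilinear_mapsD) (use True assms in auto)
    then show ?thesis
      using True vs
      by (simp add: Vector_Spaces.linear_iff circ_def lin_add lin_scale)
  next
    case False
    then show ?thesis
      using vs by (auto simp: Vector_Spaces.linear_iff circ_def)
  qed
qed

lemma linear_circ_left:
  assumes "vector_space s"
  shows "Vector_Spaces.linear (\<lambda>c g r xs. s c (g r xs)) s (\<lambda>g. circ s n m i g f r xs)"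
proof -
  interpret vector_space s by (rule assms)
  show ?thesis
    using vector_space_pointwise[OF vector_space_pointwise[OF assms]] assms
    by (auto simp: Vector_Spaces.linear_iff circ_def)
qed

lemma linear_dend_bracket:
  assumes "vector_space s" "f \<in> dend_homs s m"
  shows "Vector_Spaces.linear (\<lambda>c g r xs. s c (g r xs)) (\<lambda>c g r xs. s c (g r xs))
           (dend_bracket s m n f)"
proof -
  interpret vector_space_pair "\<lambda>c g r xs. s c (g r xs)" s
    using vector_space_pointwise[OF vector_space_pointwise[OF assms(1)]] assms(1)
    by (simp add: vector_space_pair_def)
  have "Vector_Spaces.linear (\<lambda>c g r xs. s c (g r xs)) s (\<lambda>g. dend_bracket s m n f g r xs)"
    for r xs
    unfolding dend_bracket_def
    by (intro linear_compose_sub linear_compose_sum linear_compose_scale_right ballI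
        linear_circ_left linear_circ_right assms) auto
  then show ?thesis
    using vs1.vector_space_axioms by (simp add: Vector_Spaces.linear_iff fun_eq_iff)
qed

section \<open>Totals of compositions\<close>

text \<open>
  The partial composition \<open>f \<circ>\<^sub>i g\<close> of the endomorphism operad, where \<open>n\<close> is the arity of \<open>g\<close>.
\<close>

definition partial_comp ::
  "nat \<Rightarrow> nat \<Rightarrow> ('d list \<Rightarrow> 'd) \<Rightarrow> ('d list \<Rightarrow> 'd) \<Rightarrow> 'd list \<Rightarrow> 'd" where
  "partial_comp n i f g xs =
     f (take (i - 1) xs @ [g (take n (drop (i - 1) xs))] @ drop (i + n - 1) xs)"

text \<open>
  The sum over \<open>r\<close> splits at the ends of the block \<open>i, \<dots>, i + n - 1\<close>. Before and after the block
  \<open>S_map\<close> already is the sum of all symbols, while \<open>R_map\<close> runs through the indices below and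
  above \<open>i\<close>. Within the block \<open>R_map\<close> is constantly \<open>i\<close> and \<open>S_map\<close> runs through the single symbols, so
  additivity of the \<open>i\<close>-th component in its \<open>i\<close>-th argument collects these terms.
\<close>

lemma tot_cochain_circ:
  assumes "vector_space s" "f \<in> dend_homs s m" "1 \<le> i" "i \<le> m" "1 \<le> n"
    and len: "length xs = m + n - 1"
  shows "tot_cochain (m + n - 1) (circ s m n i f g) xs
       = partial_comp n i (tot_cochain m f) (tot_cochain n g) xs"
proof -
  interpret vector_space s by (rule assms)
  obtain k where k: "n = Suc k" using assms by (cases n) auto
  define F where "F j y = f j (take (i - 1) xs @ [y] @ drop (i + n - 1) xs)" for j y
  define ys where "ys = take n (drop (i - 1) xs)"
  define c where "c r = circ s m n i f g r xs" for r
  have "f i \<in> multilinear_maps s m"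
    using assms by (auto simp: dend_homs_def tuples_def)
  then have "Vector_Spaces.linear s s (F i)"
    unfolding F_def by (rule multilinear_mapsD) (use assms in auto)
  then interpret Fi: Vector_Spaces.linear s s "F i" .
  have c: "c r = F (R_map i n r) (lin_ext s n g (S_map i n r) ys)" if "1 \<le> r" "r < m + n" for r
    using that len by (auto simp: c_def circ_def F_def ys_def)
  have all: "lin_ext s n g (\<lambda>t. if t \<in> {1..n} then 1 else 0) ys = tot_cochain n g ys"
    unfolding lin_ext_def tot_cochain_def by (intro sum.cong) auto
  have one: "lin_ext s n g (\<lambda>t. if t = j then 1 else 0) ys = g j ys" if "j \<in> {1..n}" for j
  proof -
    have "lin_ext s n g (\<lambda>t. if t = j then 1 else 0) ys = (\<Sum>t = 1..n. if t = j then g t ys else 0)"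
      unfolding lin_ext_def by (intro sum.cong) auto
    then show ?thesis using that by simp
  qed
  have left: "sum c {1..<i} = (\<Sum>r = 1..<i. F r (tot_cochain n g ys))"
    using assms by (intro sum.cong) (auto simp: c R_map_def S_map_def all[simplified])
  have "sum c {i..<i + n} = (\<Sum>r = i..<i + n. F i (g (r - i + 1) ys))"
  proof (intro sum.cong refl)
    fix r assume r: "r \<in> {i..<i + n}"
    then have "r - i + 1 \<in> {1..n}" by auto
    from one[OF this] r assms show "c r = F i (g (r - i + 1) ys)"
      by (auto simp: c R_map_def S_map_def)
  qed
  also have "\<dots> = (\<Sum>t = 0..<n. F i (g (Suc t) ys))"
    using sum.shift_bounds_nat_ivl[of "\<lambda>r. F i (g (r - i + 1) ys)" 0 i n] by (simp add: add.commute)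
  also have "\<dots> = (\<Sum>t = 1..n. F i (g t ys))"
    using sum.shift_bounds_Suc_ivl[of "\<lambda>t. F i (g t ys)" 0 n]
    by (simp add: atLeastLessThanSuc_atLeastAtMost)
  also have "\<dots> = F i (tot_cochain n g ys)"
    by (simp add: tot_cochain_def Fi.sum)
  finally have middle: "sum c {i..<i + n} = F i (tot_cochain n g ys)" .
  have "sum c {i + n..<m + n} = (\<Sum>r = i + n..<m + n. F (r - n + 1) (tot_cochain n g ys))"
    using assms by (intro sum.cong) (auto simp: c R_map_def S_map_def all[simplified])
  also have "\<dots> = (\<Sum>r = i + 1..<m + 1. F r (tot_cochain n g ys))"
    using sum.shift_bounds_nat_ivl[of "\<lambda>r. F (r - n + 1) (tot_cochain n g ys)" "i + 1" k "m + 1"]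
    by (simp add: k)
  finally have right: "sum c {i + n..<m + n} = (\<Sum>r = i + 1..<m + 1. F r (tot_cochain n g ys))" .
  have "tot_cochain (m + n - 1) (circ s m n i f g) xs = sum c {1..<m + n}"
    unfolding tot_cochain_def c_def by (intro sum.cong) (auto simp: k)
  also have "\<dots> = sum c {1..<i} + sum c {i..<i + n} + sum c {i + n..<m + n}"
    using assms by (simp add: sum.atLeastLessThan_concat)
  also have "\<dots> = (\<Sum>r = 1..<i. F r (tot_cochain n g ys)) + F i (tot_cochain n g ys)
      + (\<Sum>r = i + 1..<m + 1. F r (tot_cochain n g ys))"
    by (simp only: left middle right)
  also have "\<dots> = (\<Sum>r = 1..<m + 1. F r (tot_cochain n g ys))"
    using assms sum.atLeastLessThan_concat[of 1 i "m + 1" "\<lambda>r. F r (tot_cochain n g ys)"]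
      sum.atLeast_Suc_lessThan[of i "m + 1" "\<lambda>r. F r (tot_cochain n g ys)"]
    by (simp only: add.assoc Suc_eq_plus1)
  also have "\<dots> = partial_comp n i (tot_cochain m f) (tot_cochain n g) xs"
    by (simp add: partial_comp_def tot_cochain_def F_def ys_def atLeastLessThanSuc_atLeastAtMost)
  finally show ?thesis .
qed

lemma dend_pi_in_dend_homs:
  assumes "bilinear_op s p" "bilinear_op s q"
  shows "dend_pi p q \<in> dend_homs s 2"
proof -
  have "dend_pi p q r \<in> multilinear_maps s 2" if "r = 1 \<or> r = 2" for r
  proof -
    have "Vector_Spaces.linear s s (\<lambda>x. dend_pi p q r (xs[i := x]))"
      if len: "length xs = 2" and i: "i < 2" for xs i
    proof -
      obtain x y where "xs = [x, y]"
        using len by (auto simp: numeral_2_eq_2 length_Suc_conv)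
      moreover have "i = 0 \<or> i = 1"
        using i by auto
      ultimately show ?thesis
        using assms \<open>r = 1 \<or> r = 2\<close> by (auto simp: dend_pi_def bilinear_op_def)
    qed
    then show ?thesis
      by (auto simp: multilinear_maps_def dend_pi_def)
  qed
  moreover have "r = 1 \<or> r = 2" if "r \<in> {1..2}" for r :: nat
    using that by auto
  moreover have "dend_pi p q r = 0" if "r \<notin> {1..2}" for r
    using that by (auto simp: dend_pi_def fun_eq_iff)
  ultimately show ?thesis
    unfolding dend_homs_def tuples_def by blast
qed

lemma tot_cochain_dend_pi: "tot_cochain 2 (dend_pi p q) [x, y] = tot p q x y"
  by (simp add: tot_cochain_def dend_pi_def tot_def numeral_2_eq_2)

text \<open>
  By \<open>tot_cochain_circ\<close> the bracket becomes a combination of compositions of the total product \<open>\<star>\<close>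
  with \<open>h = f\<^sup>T\<^sup>o\<^sup>t\<close>: inserting \<open>h\<close> in the first place of \<open>\<star>\<close> gives the last term of the Hochschild
  coboundary, inserting it in the second place gives the first term, and inserting \<open>\<star>\<close> in the
  \<open>i\<close>-th place of \<open>h\<close> gives the \<open>i\<close>-th inner term. The signs of these three types in the bracket are
  \<open>1\<close>, \<open>(-1)\<^sup>n\<^sup>-\<^sup>1\<close> and \<open>-(-1)\<^sup>n\<^sup>-\<^sup>1(-1)\<^sup>i\<^sup>-\<^sup>1\<close>, and the factor \<open>(-1)\<^sup>n\<^sup>-\<^sup>1\<close> turns them into those of the
  Hochschild coboundary.
\<close>

lemma tot_cochain_dend_bracket_dend_pi:
  assumes "vector_space s" "bilinear_op s p" "bilinear_op s q" "f \<in> dend_homs s n" "1 \<le> n"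
  shows "s ((-1) ^ (n - 1)) (tot_cochain (n + 1) (dend_bracket s 2 n (dend_pi p q) f) xs)
       = hochschild s (tot p q) n (tot_cochain n f) xs"
proof (cases "length xs = n + 1")
  case False
  interpret vector_space s by (rule assms)
  show ?thesis
    using False by (simp add: tot_cochain_def dend_bracket_def circ_def hochschild_def)
next
  case True
  interpret vector_space s by (rule assms)
  let ?pi = "dend_pi p q" and ?m = "tot p q" and ?f = "tot_cochain n f"
  let ?e = "(-1) ^ (n - 1) :: 'a"
  note pi = dend_pi_in_dend_homs[OF assms(2,3)]
  have sign: "(-1) ^ (n - Suc 0) = - ((-1) ^ n :: 'a)"
    using assms(5) by (cases n) auto
  have ee: "?e * ?e = 1" by (simp flip: power_mult_distrib)
  have outer1: "tot_cochain (n + 1) (circ s 2 n 1 ?pi f) xs = ?m (?f (butlast xs)) (last xs)"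
  proof -
    have "drop n xs = [last xs]"
      using True by (metis append_butlast_last_id append_eq_conv_conj length_butlast
          diff_add_inverse2 length_0_conv add_is_0 one_neq_zero)
    then show ?thesis
      using tot_cochain_circ[OF assms(1) pi, of 1 n xs f] assms(5) True
      by (simp add: partial_comp_def tot_cochain_dend_pi butlast_conv_take)
  qed
  have outer2: "tot_cochain (n + 1) (circ s 2 n 2 ?pi f) xs = ?m (hd xs) (?f (tl xs))"
  proof -
    have "take (Suc 0) xs = [hd xs]" using True by (cases xs) auto
    then show ?thesis
      using tot_cochain_circ[OF assms(1) pi, of 2 n xs f] assms(5) True
      by (simp add: partial_comp_def tot_cochain_dend_pi drop_Suc)
  qed
  have inner: "tot_cochain (n + 1) (circ s n 2 i f ?pi) xs
      = ?f (take (i - 1) xs @ [?m (xs ! (i - 1)) (xs ! i)] @ drop (i + 1) xs)"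
    if "i \<in> {1..n}" for i
  proof -
    have "take 2 (drop (i - 1) xs) = [xs ! (i - 1), xs ! i]"
      using that True
      by (auto simp: numeral_2_eq_2 take_Suc_conv_app_nth)
    then show ?thesis
      using tot_cochain_circ[OF assms(1,4), of i 2 xs ?pi] that True
      by (simp add: partial_comp_def tot_cochain_dend_pi)
  qed
  have "tot_cochain (n + 1) (dend_bracket s 2 n ?pi f) xs
      = (\<Sum>i = 1..2. s ((-1) ^ ((i - 1) * (n - 1))) (tot_cochain (n + 1) (circ s 2 n i ?pi f) xs))
        - s ?e (\<Sum>i = 1..n. s ((-1) ^ (i - 1)) (tot_cochain (n + 1) (circ s n 2 i f ?pi) xs))"
    \<comment> \<open>Both sums over places are exchanged with the sum over the symbols.\<close>
    unfolding tot_cochain_def dend_bracket_def sum_subtractf scale_sum_right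
    by (subst (1 3) sum.swap) simp
  also have "\<dots> = ?m (?f (butlast xs)) (last xs) + s ?e (?m (hd xs) (?f (tl xs)))
      - s ?e (\<Sum>i = 1..n. s ((-1) ^ (i - 1))
          (?f (take (i - 1) xs @ [?m (xs ! (i - 1)) (xs ! i)] @ drop (i + 1) xs)))"
    (is "_ = _ - s ?e ?S")
    using inner outer1 outer2 by (simp add: numeral_2_eq_2)
  finally have "s ?e (tot_cochain (n + 1) (dend_bracket s 2 n ?pi f) xs)
      = s ?e (?m (?f (butlast xs)) (last xs)) + ?m (hd xs) (?f (tl xs)) - ?S"
    by (simp add: scale_right_distrib scale_right_diff_distrib ee)
  also have "\<dots> = s ?e (?m (?f (butlast xs)) (last xs)) + ?m (hd xs) (?f (tl xs)) + - ?S"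
    by simp
  also have "- ?S = (\<Sum>i = 1..n. s ((-1) ^ i)
          (?f (take (i - 1) xs @ [?m (xs ! (i - 1)) (xs ! i)] @ drop (i + 1) xs)))"
    unfolding sum_negf[symmetric]
  proof (intro sum.cong refl)
    fix i assume "i \<in> {1..n}"
    then obtain j where "i = Suc j" by (cases i) auto
    then show "- s ((-1) ^ (i - 1)) (?f (take (i - 1) xs @ [?m (xs ! (i - 1)) (xs ! i)] @ drop (i + 1) xs))
      = s ((-1) ^ i) (?f (take (i - 1) xs @ [?m (xs ! (i - 1)) (xs ! i)] @ drop (i + 1) xs))"
      by simp
  qed
  also have "?e = (-1) ^ (n + 1)"
    by (simp add: sign)
  finally show ?thesis
    using True by (simp add: hochschild_def sign algebra_simps)
qed

section \<open>Totalization as a chain map\<close>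

lemma tot_cochain_in_multilinear_maps:
  assumes "vector_space s" "f \<in> dend_homs s n"
  shows "tot_cochain n f \<in> multilinear_maps s n"
proof -
  interpret vector_space_pair s s using assms(1) by (simp add: vector_space_pair_def)
  show ?thesis
    using assms(2) unfolding tot_cochain_def[abs_def]
    by (auto simp: dend_homs_def tuples_def multilinear_maps_def intro!: linear_compose_sum)
qed

lemma linear_Phi:
  assumes "vector_space s"
  shows "Vector_Spaces.linear (cDend_scale s) (cAss_scale s) (Phi n)"
proof -
  interpret vector_space s by (rule assms)
  show ?thesis
    using vector_space_cDend_scale[OF assms] vector_space_cAss_scale[OF assms]
    by (simp add: Vector_Spaces.linear_iff Phi_def tot_cochain_def fun_eq_iff
        cDend_scale_def cAss_scale_def sum.distrib scale_sum_right)
qed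

lemma linear_complex_cDend:
  assumes "compatible_dendriform_algebra s prec1 succ1 prec2 succ2"
  shows "linear_complex (cDend_scale s) (cDend_cochains s) (cDend_diff s prec1 succ1 prec2 succ2)"
proof -
  interpret compatible_dendriform_algebra s prec1 succ1 prec2 succ2 by (rule assms)
  have vs: "vector_space s" by unfold_locales
  note vs2 = vector_space_pointwise[OF vector_space_pointwise[OF vs]]
  note bil = D1.bilinear_prec D1.bilinear_succ D2.bilinear_prec D2.bilinear_succ
  interpret V: vector_space "cDend_scale s" by (rule vector_space_cDend_scale[OF vs])
  interpret VV: vector_space_pair "cDend_scale s" "cDend_scale s" by unfold_locales
  show ?thesis
  proof (intro linear_complex.intro linear_complex_axioms.intro V.vector_space_axioms)
    fix n
    have "module.subspace (\<lambda>c f r xs. s c (f r xs)) (dend_homs s n)"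
      unfolding dend_homs_def
      by (rule subspace_tuples[OF vector_space_pointwise[OF vs] subspace_multilinear_maps[OF vs]])
    from subspace_tuples[OF vs2 this] show "V.subspace (cDend_cochains s n)"
      unfolding cDend_cochains_def cDend_scale_def[abs_def] .
    have "Vector_Spaces.linear (cDend_scale s) (cDend_scale s)
        (tuple_diff (dend_bracket s 2 n (dend_pi prec1 succ1))
                    (dend_bracket s 2 n (dend_pi prec2 succ2)) n)"
      unfolding cDend_scale_def[abs_def]
      by (intro linear_tuple_diff linear_dend_bracket dend_pi_in_dend_homs vs vs2 bil)
    from VV.linear_compose_scale_right[OF this, of "(-1) ^ (n - 1)"]
    show "Vector_Spaces.linear (cDend_scale s) (cDend_scale s)
        (cDend_diff s prec1 succ1 prec2 succ2 n)"
      by (simp add: cDend_diff_def[abs_def] cDend_scale_def)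
  qed
qed

text \<open>
  In positive degrees this is formal. In degree \<open>0\<close> the cochains are the image under the linear
  embedding \<open>const_cochain\<close> of the elements with equal inner derivations for both products,
  and these form a subspace.
\<close>

lemma linear_complex_cAss:
  assumes "compatible_associative_algebra s mul1 mul2"
  shows "linear_complex (cAss_scale s) (cAss_cochains s mul1 mul2) (cAss_diff s mul1 mul2)"
proof -
  interpret compatible_associative_algebra s mul1 mul2 by (rule assms)
  have vs: "vector_space s" by unfold_locales
  interpret V: vector_space "cAss_scale s" by (rule vector_space_cAss_scale[OF vs])
  have mul_scale: "mul1 x (s c y) = s c (mul1 x y)" "mul1 (s c x) y = s c (mul1 x y)"
    "mul2 x (s c y) = s c (mul2 x y)" "mul2 (s c x) y = s c (mul2 x y)" for c x y
    using bilinear_mul1 bilinear_mul2 by (auto simp: bilinear_op_def Vector_Spaces.linear_iff)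
  note mul_simps = mul_scale bilinear_opD[OF bilinear_mul1] bilinear_opD[OF bilinear_mul2]
  note hoch = linear_hochschild[OF vs bilinear_mul1] linear_hochschild[OF vs bilinear_mul2]
  show ?thesis
  proof (intro linear_complex.intro linear_complex_axioms.intro V.vector_space_axioms)
    fix n
    show "V.subspace (cAss_cochains s mul1 mul2 n)"
    proof (cases "n = 0")
      case True
      have "Vector_Spaces.linear s (cAss_scale s) const_cochain"
        using vs V.vector_space_axioms
        by (auto simp: Vector_Spaces.linear_iff const_cochain_def cAss_scale_def fun_eq_iff)
      then interpret const: Vector_Spaces.linear s "cAss_scale s" const_cochain .
      let ?K = "{b. \<forall>a. mul1 a b - mul1 b a = mul2 a b - mul2 b a}"
      have "subspace ?K"
        using mul_scale(1,3)[of _ 0 0] mul_scale(2,4)[of 0 0]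
        by (auto simp: subspace_def mul_simps add_diff_add simp flip: scale_right_diff_distrib)
      then show ?thesis
        using True const.subspace_image by (simp add: cAss_cochains_def)
    next
      case False
      then show ?thesis
        using subspace_tuples[OF vector_space_pointwise[OF vs] subspace_multilinear_maps[OF vs, of n], of n]
        by (simp add: cAss_cochains_def cAss_scale_def[abs_def])
    qed
    show "Vector_Spaces.linear (cAss_scale s) (cAss_scale s) (cAss_diff s mul1 mul2 n)"
    proof (cases "n = 0")
      case True
      then show ?thesis
        using hoch(1)[of 0] V.vector_space_axioms
        by (auto simp: Vector_Spaces.linear_iff cAss_diff_def cAss_scale_def fun_eq_iff)
    next
      case False
      then have "cAss_diff s mul1 mul2 n = tuple_diff (hochschild s mul1 n) (hochschild s mul2 n) n"
        by (simp add: cAss_diff_def fun_eq_iff)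
      then show ?thesis
        using linear_tuple_diff[OF vector_space_pointwise[OF vs] hoch]
        by (simp add: cAss_scale_def[abs_def])
    qed
  qed
qed

lemma Phi_cochains:
  assumes "compatible_associative_algebra s mul1 mul2"
  shows "Phi n \<in> cDend_cochains s n \<rightarrow> cAss_cochains s mul1 mul2 n"
proof (cases n)
  case 0
  interpret linear_complex "cAss_scale s" "cAss_cochains s mul1 mul2" "cAss_diff s mul1 mul2"
    by (rule linear_complex_cAss[OF assms])
  show ?thesis
    using 0 subspace_0[OF subspace_cochains[of 0]] by (simp add: Phi_def zero_fun_def)
next
  case (Suc k)
  interpret compatible_associative_algebra s mul1 mul2 by (rule assms)
  show ?thesis
    using Suc tot_cochain_in_multilinear_maps[OF vector_space_axioms]
    by (auto simp: cDend_cochains_def cAss_cochains_def tuples_def Phi_def)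
qed

text \<open>
  In degree \<open>0\<close> the source is zero and both sides vanish. In positive degrees the claim is checked in
  each place \<open>i\<close> of the tuple, where it is \<open>tot_cochain_dend_bracket_dend_pi\<close> for each of the
  summands present.
\<close>

lemma Phi_cDend_diff:
  assumes "compatible_dendriform_algebra s prec1 succ1 prec2 succ2" "F \<in> cDend_cochains s n"
  shows "Phi (Suc n) (cDend_diff s prec1 succ1 prec2 succ2 n F)
       = cAss_diff s (tot prec1 succ1) (tot prec2 succ2) n (Phi n F)"
proof -
  interpret compatible_dendriform_algebra s prec1 succ1 prec2 succ2 by (rule assms)
  have vs: "vector_space s" by unfold_locales
  note bil = D1.bilinear_prec D1.bilinear_succ D2.bilinear_prec D2.bilinear_succ
  show ?thesis
  proof (cases "n = 0")
    case True
    interpret dD: Vector_Spaces.linear "cDend_scale s" "cDend_scale s"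
        "cDend_diff s prec1 succ1 prec2 succ2 0"
      by (rule linear_complex.linear_d[OF linear_complex_cDend[OF assms(1)]])
    interpret dA: Vector_Spaces.linear "cAss_scale s" "cAss_scale s"
        "cAss_diff s (tot prec1 succ1) (tot prec2 succ2) 0"
      by (rule linear_complex.linear_d[OF linear_complex_cAss[OF compatible_associative_tot[OF assms(1)]]])
    interpret P: Vector_Spaces.linear "cDend_scale s" "cAss_scale s" "Phi m" for m
      by (rule linear_Phi[OF vs])
    have "F = 0" using assms(2) True by (auto simp: cDend_cochains_def tuples_def)
    then show ?thesis using True by (simp add: dD.zero dA.zero P.zero)
  next
    case False
    let ?e = "(-1) ^ (n - 1) :: 'a"
    let ?b1 = "dend_bracket s 2 n (dend_pi prec1 succ1)"
      and ?b2 = "dend_bracket s 2 n (dend_pi prec2 succ2)"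
    have F: "F j \<in> dend_homs s n" if "j \<in> {1..n}" for j
      using assms(2) that by (auto simp: cDend_cochains_def tuples_def)
    have hoch:
      "hochschild s (tot prec1 succ1) n (tot_cochain n (F j)) xs
         = s ?e (tot_cochain (n + 1) (?b1 (F j)) xs)"
      "hochschild s (tot prec2 succ2) n (tot_cochain n (F j)) xs
         = s ?e (tot_cochain (n + 1) (?b2 (F j)) xs)" if "j \<in> {1..n}" for j xs
      using False
      by (simp_all only: tot_cochain_dend_bracket_dend_pi[OF vs _ _ F[OF that]] bil less_one not_less)
    show ?thesis
    proof (intro ext)
      fix i xs
      show "Phi (Suc n) (cDend_diff s prec1 succ1 prec2 succ2 n F) i xs
          = cAss_diff s (tot prec1 succ1) (tot prec2 succ2) n (Phi n F) i xs"
        using False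
        by (auto simp: Phi_def cAss_diff_def tuple_diff_def hoch[simplified] cDend_diff_def
            tot_cochain_def[of "Suc n"] D1.scale_right_distrib sum.distrib D1.scale_sum_right)
    qed
  qed
qed

theorem theorem5p11:
  fixes s :: "'k::field_char_0 \<Rightarrow> 'd::ab_group_add \<Rightarrow> 'd"
    and prec1 succ1 prec2 succ2 :: "'d \<Rightarrow> 'd \<Rightarrow> 'd"
  defines "CD \<equiv> cDend_cochains s"
    and "dD \<equiv> cDend_diff s prec1 succ1 prec2 succ2"
    and "CA \<equiv> cAss_cochains s (tot prec1 succ1) (tot prec2 succ2)"
    and "dA \<equiv> cAss_diff s (tot prec1 succ1) (tot prec2 succ2)"
  assumes "compatible_dendriform_algebra s prec1 succ1 prec2 succ2"
  shows "\<exists>h. \<forall>n.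
           Phi n \<in> CD n \<rightarrow> CA n \<and>
           cohomology_linear (cDend_scale s) CD dD (cAss_scale s) CA dA n (h n) \<and>
           (\<forall>F \<in> cocycles CD dD n.
              Phi n F \<in> cocycles CA dA n \<and>
              h n (cohomology_class CD dD n F) = cohomology_class CA dA n (Phi n F))"
proof -
  interpret compatible_dendriform_algebra s prec1 succ1 prec2 succ2 by (rule assms)
  have vs: "vector_space s" by unfold_locales
  interpret chain_map "cDend_scale s" CD dD "cAss_scale s" CA dA Phi
    unfolding CD_def dD_def CA_def dA_def
    by (intro chain_map.intro chain_map_axioms.intro linear_complex_cDend linear_complex_cAss
        compatible_associative_tot linear_Phi Phi_cochains Phi_cDend_diff vs assms(5))
  show ?thesis
    using maps_cochains cohomology_linear_induced maps_cocycles induced_cohomology_class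
    by (intro exI[of _ induced]) simp
qed

end
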